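(* Let $l\in\mathbb{N}$ with $l\equiv1\pmod 2$, $h\in\mathbb{Z}$, $m\ge0$ an integer and $x\in\mathbb{Z}_p$. Then $$\frac{[2]_q}{[2]_{q^l}}[l]_q^m\sum_{i=0}^{l-1}q^{hi}(-1)^iE_{m,q^l}^{(h,1)}\Big(\frac{x+i}{l}\Big)=E_{m,q}^{(h,1)}(x).$$ Furthermore, $$\frac{[2]_q}{[2]_{q^l}}[l]_q^m\sum_{i=0}^{l-1}q^{hi}(-1)^iE_{m,q^l}^{(h,1)}\Big(x+\frac{i}{l}\Big)=E_{m,q}^{(h,1)}(lx).$$
   Context: Let $p$ be an odd prime, $\mathbb{C}_p$ the completion of the algebraic closure of $\mathbb{Q}_p$, with $|p|_p=p^{-1}$. Let $q\in\mathbb{C}_p$ with $|1-q|_p<p^{-1/(p-1)}$. For $Q\in\{q,q^l\}$ and $x\in\mathbb{Z}_p$ put $Q^x=\exp(x\log Q)$, $[x]_Q=\frac{1-Q^x}{1-Q}$, $[2]_Q=1+Q$. For $f:\mathbb{Z}_p\to\mathbb{C}_p$ (uniformly differentiable) define $$\int_{\mathbb{Z}_p}f(x)\,d\mu_{-Q}(x)=\lim_{N\to\infty}\frac{[2]_Q}{1+Q^{p^N}}\sum_{x=0}^{p^N-1}f(x)(-1)^xQ^x.$$ For $h\in\mathbb{Z}$, integers $m\ge0$ define $$E_{m,Q}^{(h,1)}(y)=\int_{\mathbb{Z}_p}[y+x_1]_Q^m\,Q^{(h-1)x_1}\,d\mu_{-Q}(x_1).$$ When $Q=q^l$ and the argument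 $y$ satisfies $ly\in\mathbb{Z}_p$, the power $(q^l)^{y+x_1}$ is understood as $q^{ly+lx_1}$. *)

theory Defs
  imports "HOL-Analysis.Analysis" "HOL-Computational_Algebra.Computational_Algebra"
begin

text \<open>
  The field \<open>\<complex>\<^sub>p\<close> is characterised up to isometric isomorphism as the completion of an algebraic
  closure of \<open>\<rat>\<^sub>p\<close>.  It is carried by a type that is a complete metric space whose metric comes
  from the absolute value \<open>\<bar>x\<bar>\<^sub>p = dist x 0\<close>;
  there, \<open>\<rat>\<^sub>p\<close> is the topological closure of the rationals.
\<close>

definition absp :: "'a::{zero,metric_space} \<Rightarrow> real" where
  "absp x = dist x 0"

definition Qp :: "'a::{field_char_0,metric_space} set" where
  "Qp = closure \<rat>"

definition Zp :: "'a::{field_char_0,metric_space} set" where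
  "Zp = {x \<in> Qp. absp x \<le> 1}"

definition Qp_alg :: "'a::{field_char_0,metric_space} set" where
  "Qp_alg = {x. \<exists>P :: 'a poly. P \<noteq> 0 \<and> (\<forall>i. coeff P i \<in> Qp) \<and> poly P x = 0}"

definition padic_complex_field :: "nat \<Rightarrow> 'a::{field_char_0,complete_space} itself \<Rightarrow> bool" where
  "padic_complex_field p K \<longleftrightarrow>
     prime p \<and>
     (\<forall>x y :: 'a. dist x y = absp (x - y)) \<and>
     (\<forall>x y :: 'a. absp (x * y) = absp x * absp y) \<and>
     (\<forall>x y :: 'a. absp (x + y) \<le> max (absp x) (absp y)) \<and>
     absp (of_nat p :: 'a) = 1 / real p \<and>
     (\<forall>P :: 'a poly. degree P > 0 \<and> (\<forall>i. coeff P i \<in> Qp_alg) \<longrightarrow>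
        (\<exists>x \<in> Qp_alg. poly P x = 0)) \<and>
     closure (Qp_alg :: 'a set) = UNIV"

definition padic_exp :: "'a::{field_char_0,metric_space} \<Rightarrow> 'a" where
  "padic_exp z = (\<Sum>n. z ^ n / fact n)"

definition padic_log :: "'a::{field_char_0,metric_space} \<Rightarrow> 'a" where
  "padic_log z = (\<Sum>n. (-1) ^ n * (z - 1) ^ Suc n / of_nat (Suc n))"

definition qpow :: "'a::{field_char_0,metric_space} \<Rightarrow> 'a \<Rightarrow> 'a" where
  "qpow Q x = padic_exp (x * padic_log Q)"

text \<open>
  \<open>qbracket q l y\<close> is \<open>[y]\<close> to the base \<open>Q = q\<^sup>l\<close> for \<open>l * y \<in> \<int>\<^sub>p\<close>; here \<open>y\<close> itself need not lie
  in \<open>\<int>\<^sub>p\<close>, and \<open>Q\<^sup>y\<close> is read as \<open>q\<close> to the power \<open>l * y\<close>.  The case \<open>Q = 1\<close>, where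
  \<open>(1 - Q\<^sup>y) / (1 - Q)\<close> is undefined, gets the limiting value \<open>y\<close>.
\<close>

definition qbracket :: "'a::{field_char_0,metric_space} \<Rightarrow> nat \<Rightarrow> 'a \<Rightarrow> 'a" where
  "qbracket q l y = (if q ^ l = 1 then y else (1 - qpow q (of_nat l * y)) / (1 - q ^ l))"

definition qtwo :: "'a::{field_char_0,metric_space} \<Rightarrow> 'a" where
  "qtwo Q = 1 + Q"

definition fermionic_integral ::
    "nat \<Rightarrow> 'a::{field_char_0,metric_space} \<Rightarrow> ('a \<Rightarrow> 'a) \<Rightarrow> 'a" where
  "fermionic_integral p Q f =
     lim (\<lambda>N. qtwo Q / (1 + qpow Q (of_nat (p ^ N))) *
              (\<Sum>x<p ^ N. f (of_nat x) * (-1) ^ x * qpow Q (of_nat x)))"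

text \<open>\<open>qEuler p q l h m y\<close> is \<open>E\<close> with indices \<open>m, Q\<close> and \<open>(h, 1)\<close> at \<open>y\<close>, for the base \<open>Q = q\<^sup>l\<close>.\<close>

definition qEuler ::
    "nat \<Rightarrow> 'a::{field_char_0,metric_space} \<Rightarrow> nat \<Rightarrow> int \<Rightarrow> nat \<Rightarrow> 'a \<Rightarrow> 'a" where
  "qEuler p q l h m y =
     fermionic_integral p (q ^ l)
       (\<lambda>x\<^sub>1. qbracket q l (y + x\<^sub>1) ^ m * qpow (q ^ l) (of_int (h - 1) * x\<^sub>1))"

end

theory Submission
  imports Defs
begin

text \<open>
  With \<open>F n = [x + n]\<^sub>q\<^sup>m q\<^sup>h\<^sup>n\<close> and \<open>S n\<close> the alternating sum of \<open>F\<close> over \<open>{..<n}\<close>, the right-hand side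
  is \<open>(1 + q) / 2\<close> times the limit of \<open>S (p\<^sup>N)\<close>.  Splitting a summation index below \<open>l * p\<^sup>N\<close> by its
  residue modulo \<open>l\<close> shows that the left-hand side is \<open>(1 + q) / 2\<close> times the limit of
  \<open>S (l * p\<^sup>N)\<close>.  Both limits exist and agree, because \<open>F\<close> is Lipschitz for the \<open>p\<close>-adic absolute
  value: splitting by blocks of length \<open>p\<^sup>N\<close> instead, consecutive blocks cancel up to \<open>O(p\<^sup>-\<^sup>N)\<close>.
  The second identity is the first one at \<open>l * x\<close>.
\<close>

section \<open>Ultrametric fields\<close>

locale ultrametric_field =
  fixes K :: "'a::{field_char_0,complete_space} itself"
  assumes dist_absp: "dist (x::'a) y = absp (x - y)"
    and absp_mult: "absp ((x::'a) * y) = absp x * absp y"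
    and absp_ultra: "absp ((x::'a) + y) \<le> max (absp x) (absp y)"
begin

lemma absp_nonneg [simp]: "0 \<le> absp (x::'a)"
  by (simp add: absp_def)

lemma absp_0 [simp]: "absp (0::'a) = 0"
  by (simp add: absp_def)

lemma absp_eq_0_iff [simp]: "absp (x::'a) = 0 \<longleftrightarrow> x = 0"
  by (simp add: absp_def)

lemma absp_pos_iff [simp]: "0 < absp (x::'a) \<longleftrightarrow> x \<noteq> 0"
  by (simp add: absp_def)

lemma absp_1 [simp]: "absp (1::'a) = 1"
  using absp_mult[of 1 1] by simp

lemma absp_minus_commute: "absp ((x::'a) - y) = absp (y - x)"
  by (metis dist_absp dist_commute)

lemma absp_minus [simp]: "absp (- (x::'a)) = absp x"
  using absp_minus_commute[of 0 x] by simp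

lemma absp_power: "absp ((x::'a) ^ n) = absp x ^ n"
  by (induction n) (simp_all add: absp_mult)

lemma absp_divide: "absp ((x::'a) / y) = absp x / absp y"
proof (cases "y = 0")
  case False
  then show ?thesis
    using absp_mult[of "x / y" y] by (simp add: field_simps)
qed simp

lemma absp_neg_one_power [simp]: "absp ((-1::'a) ^ n) = 1"
  by (simp add: absp_power)

lemma absp_add_le: "absp (x::'a) \<le> B \<Longrightarrow> absp y \<le> B \<Longrightarrow> absp (x + y) \<le> B"
  using absp_ultra[of x y] by simp

lemma absp_diff_le: "absp (x::'a) \<le> B \<Longrightarrow> absp y \<le> B \<Longrightarrow> absp (x - y) \<le> B"
  using absp_add_le[of x B "-y"] by simp

lemma absp_add_less: "absp (x::'a) < B \<Longrightarrow> absp y < B \<Longrightarrow> absp (x + y) < B"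
  using absp_ultra[of x y] by simp

lemma absp_add_eq:
  assumes "absp (y::'a) < absp x"
  shows "absp (x + y) = absp x"
proof (rule antisym)
  show "absp (x + y) \<le> absp x"
    using assms by (intro absp_add_le) auto
  have "absp x \<le> max (absp (x + y)) (absp y)"
    using absp_ultra[of "x + y" "-y"] by simp
  then show "absp x \<le> absp (x + y)"
    using assms by linarith
qed

lemma absp_sum_le:
  fixes f :: "'b \<Rightarrow> 'a"
  assumes "\<And>i. i \<in> A \<Longrightarrow> absp (f i) \<le> B" and "0 \<le> B"
  shows "absp (sum f A) \<le> B"
  using assms by (induction A rule: infinite_finite_induct) (auto intro: absp_add_le)

lemma absp_of_nat_le_1 [simp]: "absp (of_nat n :: 'a) \<le> 1"
  by (induction n) (auto intro: absp_add_le)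

lemma absp_of_int_le_1 [simp]: "absp (of_int n :: 'a) \<le> 1"
  by (cases n rule: int_cases2) simp_all

lemma absp_fact_le_1 [simp]: "absp (fact n :: 'a) \<le> 1"
  by (metis absp_of_nat_le_1 of_nat_fact)

section \<open>Limits and series with respect to an ultrametric absolute value\<close>

lemma tendsto_iff_absp:
  fixes X :: "nat \<Rightarrow> 'a"
  shows "X \<longlonglongrightarrow> L \<longleftrightarrow> (\<lambda>n. absp (X n - L)) \<longlonglongrightarrow> 0"
  unfolding tendsto_dist_iff[of X] dist_absp ..

lemma tendstoI_absp:
  fixes X :: "nat \<Rightarrow> 'a"
  assumes "\<And>n. absp (X n - L) \<le> e n" and "e \<longlonglongrightarrow> 0"
  shows "X \<longlonglongrightarrow> L"
  unfolding tendsto_iff_absp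
  by (rule tendsto_sandwich[OF _ _ tendsto_const assms(2)]) (use assms(1) in auto)

lemma tendsto_absp: "X \<longlonglongrightarrow> (L::'a) \<Longrightarrow> (\<lambda>n. absp (X n)) \<longlonglongrightarrow> absp L"
  unfolding absp_def by (intro tendsto_intros)

text \<open>The sort of \<open>'a\<close> does not tie the metric to the field operations, so their
  continuity is derived here and below from the ultrametric inequality.\<close>

lemma tendsto_add_absp:
  fixes X Y :: "nat \<Rightarrow> 'a"
  assumes "X \<longlonglongrightarrow> a" "Y \<longlonglongrightarrow> b"
  shows "(\<lambda>n. X n + Y n) \<longlonglongrightarrow> a + b"
proof (rule tendstoI_absp)
  show "absp (X n + Y n - (a + b)) \<le> max (absp (X n - a)) (absp (Y n - b))" for n
    using absp_ultra[of "X n - a" "Y n - b"] by (simp add: algebra_simps)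
  show "(\<lambda>n. max (absp (X n - a)) (absp (Y n - b))) \<longlonglongrightarrow> 0"
    using tendsto_max[OF assms[unfolded tendsto_iff_absp]] by simp
qed

lemma tendsto_mult_absp:
  fixes X Y :: "nat \<Rightarrow> 'a"
  assumes "X \<longlonglongrightarrow> a" "Y \<longlonglongrightarrow> b"
  shows "(\<lambda>n. X n * Y n) \<longlonglongrightarrow> a * b"
proof (rule tendstoI_absp)
  show "absp (X n * Y n - a * b) \<le>
      max (absp (X n - a) * absp (Y n)) (absp a * absp (Y n - b))" for n
    using absp_ultra[of "(X n - a) * Y n" "a * (Y n - b)"]
    by (simp add: algebra_simps flip: absp_mult)
  have "(\<lambda>n. max (absp (X n - a) * absp (Y n)) (absp a * absp (Y n - b)))
      \<longlonglongrightarrow> max (0 * absp b) (absp a * 0)"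
    using assms[unfolded tendsto_iff_absp] tendsto_absp[OF assms(2)]
    by (intro tendsto_intros)
  then show "(\<lambda>n. max (absp (X n - a) * absp (Y n)) (absp a * absp (Y n - b))) \<longlonglongrightarrow> 0"
    by simp
qed

lemma tendsto_cmult_absp:
  fixes X :: "nat \<Rightarrow> 'a"
  shows "X \<longlonglongrightarrow> a \<Longrightarrow> (\<lambda>n. c * X n) \<longlonglongrightarrow> c * a"
  by (intro tendsto_mult_absp tendsto_const)

lemma tendsto_diff_absp:
  fixes X Y :: "nat \<Rightarrow> 'a"
  assumes "X \<longlonglongrightarrow> a" "Y \<longlonglongrightarrow> b"
  shows "(\<lambda>n. X n - Y n) \<longlonglongrightarrow> a - b"
  using tendsto_add_absp[OF assms(1) tendsto_cmult_absp[OF assms(2), of "-1"]] by simp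

lemma tendsto_sum_absp:
  fixes X :: "'b \<Rightarrow> nat \<Rightarrow> 'a"
  assumes "\<And>i. i \<in> A \<Longrightarrow> X i \<longlonglongrightarrow> L i"
  shows "(\<lambda>n. \<Sum>i\<in>A. X i n) \<longlonglongrightarrow> (\<Sum>i\<in>A. L i)"
  using assms
  by (induction A rule: infinite_finite_induct) (simp_all add: tendsto_add_absp)

lemma tendsto_inverse_absp:
  fixes X :: "nat \<Rightarrow> 'a"
  assumes X: "X \<longlonglongrightarrow> a" and nz: "\<And>n. X n \<noteq> 0" "a \<noteq> 0"
  shows "(\<lambda>n. 1 / X n) \<longlonglongrightarrow> 1 / a"
proof (rule tendstoI_absp)
  have "1 / X n - 1 / a = (a - X n) / (X n * a)" for n
    using nz by (simp add: field_simps)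
  then show "absp (1 / X n - 1 / a) \<le> absp (X n - a) / (absp (X n) * absp a)" for n
    by (simp add: absp_divide absp_mult absp_minus_commute)
  have "(\<lambda>n. absp (X n - a) / (absp (X n) * absp a)) \<longlonglongrightarrow> 0 / (absp a * absp a)"
    using X[unfolded tendsto_iff_absp] tendsto_absp[OF X] nz
    by (intro tendsto_intros) auto
  then show "(\<lambda>n. absp (X n - a) / (absp (X n) * absp a)) \<longlonglongrightarrow> 0"
    by simp
qed

text \<open>A distance \<open>X n - X N\<close> is bounded by the largest consecutive difference in
  between instead of their sum, so vanishing consecutive differences already give a Cauchy
  sequence.\<close>

lemma convergent_absp:
  fixes X :: "nat \<Rightarrow> 'a"
  assumes "(\<lambda>n. absp (X (Suc n) - X n)) \<longlonglongrightarrow> 0"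
  shows "convergent X"
proof (rule Cauchy_convergent, rule metric_CauchyI)
  fix e :: real
  assume e: "e > 0"
  obtain N where N: "\<And>n. n \<ge> N \<Longrightarrow> absp (X (Suc n) - X n) < e"
    using LIMSEQ_D[OF assms e] by auto
  have far: "absp (X n - X N) < e" if "n \<ge> N" for n
    using that
  proof (induction n rule: dec_induct)
    case base
    then show ?case using e by simp
  next
    case (step n)
    then show ?case
      using absp_add_less[of "X (Suc n) - X n" e "X n - X N"] N[of n] by simp
  qed
  have "dist (X m) (X n) < e" if "m \<ge> N" "n \<ge> N" for m n
    using absp_add_less[of "X m - X N" e "X N - X n"] far[OF that(1)] far[OF that(2)]
    by (simp add: dist_absp absp_minus_commute)
  then show "\<exists>M. \<forall>m\<ge>M. \<forall>n\<ge>M. dist (X m) (X n) < e"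
    by blast
qed

lemma sums_suminf_absp:
  fixes f :: "nat \<Rightarrow> 'a"
  assumes "(\<lambda>n. absp (f n)) \<longlonglongrightarrow> 0"
  shows "f sums (suminf f)"
proof -
  have "convergent (\<lambda>n. sum f {..<n})"
    using assms by (intro convergent_absp) simp
  then show ?thesis
    by (simp add: summable_iff_convergent summable_sums)
qed

text \<open>A tail is no larger than its largest term. With \<open>k = 1\<close> and
  \<open>k = 2\<close> this yields the first and second order estimates for the exponential.\<close>

lemma absp_sums_diff_le:
  fixes f :: "nat \<Rightarrow> 'a"
  assumes "f sums s" and "\<And>n. n \<ge> k \<Longrightarrow> absp (f n) \<le> B" and "0 \<le> B"
  shows "absp (s - sum f {..<k}) \<le> B"
proof (rule tendsto_upperbound)
  show "(\<lambda>n. absp (sum f {..<n} - sum f {..<k})) \<longlonglongrightarrow> absp (s - sum f {..<k})"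
    using assms(1) unfolding sums_def
    by (intro tendsto_absp tendsto_diff_absp tendsto_const)
  show "\<forall>\<^sub>F n in sequentially. absp (sum f {..<n} - sum f {..<k}) \<le> B"
    using eventually_ge_at_top[of k]
  proof eventually_elim
    case (elim n)
    then have "sum f {..<n} - sum f {..<k} = sum f {k..<n}"
      by (simp add: lessThan_atLeast0 sum_diff_nat_ivl)
    then show ?case
      using assms(2,3) by (auto intro: absp_sum_le)
  qed
qed simp

end

section \<open>The \<open>p\<close>-adic exponential and logarithm\<close>

text \<open>The binomial theorem turns each degree \<open>k\<close> into an antidiagonal, and
  together these form a triangle; \<open>padic_exp_add\<close> compares it with the square coming
  from a product of two partial sums.\<close>

lemma exp_partial_sum_add:
  fixes a b :: "'b::field_char_0"
  shows "(\<Sum>k<n. (a + b) ^ k / fact k) =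
    (\<Sum>(i,j) | i + j < n. (a ^ i / fact i) * (b ^ j / fact j))"
proof -
  have "(a + b) ^ k / fact k = (\<Sum>i\<le>k. (a ^ i / fact i) * (b ^ (k - i) / fact (k - i)))" for k
  proof -
    have "(a + b) ^ k / fact k = (\<Sum>i\<le>k. of_nat (k choose i) * a ^ i * b ^ (k - i) / fact k)"
      by (simp add: binomial_ring sum_divide_distrib)
    also have "\<dots> = (\<Sum>i\<le>k. (a ^ i / fact i) * (b ^ (k - i) / fact (k - i)))"
      by (intro sum.cong refl) (simp add: binomial_fact)
    finally show ?thesis .
  qed
  then show ?thesis
    by (simp add: sum.triangle_reindex)
qed

text \<open>Absorption, \<open>(k + 1) * (n choose Suc k) = n * ((n - 1) choose k)\<close>, pulls
  out the factor \<open>n\<close>. What remains is the logarithm series with its signs replaced by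
  binomial coefficients.\<close>

lemma binomial_minus_one_expansion:
  fixes u :: "'b::field_char_0"
  shows "(1 + u) ^ n - 1 =
    of_nat n * (\<Sum>k<n. of_nat ((n - 1) choose k) * (u ^ Suc k / of_nat (Suc k)))"
proof -
  have "(1 + u) ^ n = (\<Sum>k\<le>n. of_nat (n choose k) * u ^ k)"
    using binomial_ring[of u 1 n] by (simp add: add.commute)
  also have "\<dots> = 1 + (\<Sum>k<n. of_nat (n choose Suc k) * u ^ Suc k)"
    by (simp add: sum.atMost_shift)
  also have "(\<Sum>k<n. of_nat (n choose Suc k) * u ^ Suc k) =
      of_nat n * (\<Sum>k<n. of_nat ((n - 1) choose k) * (u ^ Suc k / of_nat (Suc k)))"
    unfolding sum_distrib_left
  proof (intro sum.cong refl)
    fix k assume "k \<in> {..<n}"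
    then obtain n' where n': "n = Suc n'"
      by (cases n) auto
    have "of_nat (Suc k) * of_nat (n choose Suc k) = (of_nat n * of_nat ((n - 1) choose k) :: 'b)"
      unfolding n' using Suc_times_binomial[of k n'] by (simp only: diff_Suc_1 flip: of_nat_mult)
    then have "of_nat (n choose Suc k) = (of_nat n * of_nat ((n - 1) choose k) / of_nat (Suc k) :: 'b)"
      by (simp add: field_simps del: of_nat_Suc)
    then show "of_nat (n choose Suc k) * u ^ Suc k =
        of_nat n * (of_nat ((n - 1) choose k) * (u ^ Suc k / of_nat (Suc k)))"
      by simp
  qed
  finally show ?thesis by simp
qed

lemma sum_neg_one_power_odd: "odd l \<Longrightarrow> (\<Sum>j<l. (-1) ^ j :: 'b::ring_1) = 1"
proof -
  have "(\<Sum>j<l. (-1) ^ j :: 'b) = (if odd l then 1 else 0)"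
    by (induction l) auto
  then show "odd l \<Longrightarrow> ?thesis" by simp
qed

locale padic_field = ultrametric_field K
  for K :: "'a::{field_char_0,complete_space} itself" +
  fixes p :: nat
  assumes prime_p: "prime p"
    and absp_p: "absp (of_nat p :: 'a) = 1 / real p"
begin

section \<open>Absolute values of integers, factorials and series terms\<close>

definition exp_radius :: real where
  "exp_radius = real p powr (- 1 / (real p - 1))"

lemma p_gt_1: "p > 1"
  using prime_p prime_gt_1_nat by blast

lemma exp_radius_pos: "exp_radius > 0"
  using p_gt_1 by (simp add: exp_radius_def)

lemma exp_radius_less_1: "exp_radius < 1"
  using p_gt_1 by (simp add: exp_radius_def powr_less_one)

text \<open>This is the form in which the radius enters Legendre's bound: \<open>p - 1\<close>
  factors of it amount to one factor \<open>p\<close> in a factorial.\<close>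

lemma exp_radius_power: "exp_radius ^ (p - 1) = 1 / real p"
proof -
  have "exp_radius ^ (p - 1) = real p powr ((- 1 / (real p - 1)) * real (p - 1))"
    using p_gt_1 by (simp add: exp_radius_def powr_powr flip: powr_realpow)
  also have "(- 1 / (real p - 1)) * real (p - 1) = -1"
    using p_gt_1 by (simp add: of_nat_diff)
  finally show ?thesis
    using p_gt_1 by (simp add: powr_minus divide_inverse)
qed

text \<open>In a Bezout relation \<open>a * p + b * n = 1\<close>, a value \<open>absp n < 1\<close>
  would make both summands smaller than 1, but \<open>absp 1 = 1\<close>.\<close>

lemma absp_of_nat_not_dvd:
  assumes "\<not> p dvd n"
  shows "absp (of_nat n :: 'a) = 1"
proof (rule ccontr)
  assume "absp (of_nat n :: 'a) \<noteq> 1"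
  then have less: "absp (of_nat n :: 'a) < 1"
    by (simp add: order_less_le)
  have "coprime (int p) (int n)"
    using assms prime_p by (simp add: prime_imp_coprime)
  then obtain a b where "a * int p + b * int n = 1"
    using bezout_int[of "int p" "int n"] by auto
  then have "(of_int a * of_nat p + of_int b * of_nat n :: 'a) = 1"
    by (metis of_int_1 of_int_add of_int_mult of_int_of_nat_eq)
  moreover have "absp (of_int a * of_nat p :: 'a) < 1"
  proof -
    have "absp (of_int a * of_nat p :: 'a) \<le> 1 / real p"
      unfolding absp_mult absp_p by (intro mult_left_le_one_le) auto
    also have "\<dots> < 1"
      using p_gt_1 by simp
    finally show ?thesis .
  qed
  moreover have "absp (of_int b * of_nat n :: 'a) < 1"
    using less absp_of_int_le_1[of b]
    by (metis absp_mult absp_nonneg mult_le_one mult_left_le_one_le order_le_less_trans)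
  ultimately show False
    using absp_add_less by (metis absp_1 less_irrefl)
qed

lemma absp_fact_mult_add:
  "s < p \<Longrightarrow> absp (fact (p * n + s) :: 'a) = absp (fact (p * n) :: 'a)"
proof (induction s)
  case (Suc s)
  have "\<not> p dvd Suc (p * n + s)"
    using Suc.prems by (metis add_Suc_right dvd_add_right_iff dvd_imp_le dvd_triv_left not_le zero_less_Suc)
  then have "absp (of_nat (Suc (p * n + s)) :: 'a) = 1"
    by (rule absp_of_nat_not_dvd)
  then show ?case
    using Suc by (simp add: absp_mult del: of_nat_Suc)
qed simp

text \<open>Only the multiples of \<open>p\<close> among the factors are non-units, and
  \<open>p, 2p, ..., np\<close> multiply to \<open>p ^ n * n!\<close>.\<close>

lemma absp_fact_mult:
  "absp (fact (p * n) :: 'a) = absp (fact n :: 'a) / real p ^ n"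
proof (induction n)
  case (Suc n)
  have "p * Suc n = Suc (p * n + (p - 1))"
    using p_gt_1 by simp
  then have "absp (fact (p * Suc n) :: 'a)
      = absp (of_nat (p * Suc n) :: 'a) * absp (fact (p * n + (p - 1)) :: 'a)"
    by (metis absp_mult fact_Suc of_nat_mult)
  also have "absp (fact (p * n + (p - 1)) :: 'a) = absp (fact (p * n) :: 'a)"
    using p_gt_1 by (intro absp_fact_mult_add) simp
  finally show ?case
    using Suc absp_p by (simp add: absp_mult of_nat_mult mult.commute del: of_nat_Suc mult_Suc_right)
qed simp

text \<open>Legendre's bound: \<open>n!\<close> has \<open>p\<close>-adic valuation at most \<open>(n - 1) / (p - 1)\<close> for \<open>n > 0\<close>.\<close>

lemma absp_fact_ge: "exp_radius ^ (n - 1) \<le> absp (fact n :: 'a)"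
proof (induction n rule: less_induct)
  case (less n)
  \<comment> \<open>Up to units \<open>n!\<close> equals \<open>p ^ k * k!\<close>, so the induction
    passes from \<open>n\<close> to \<open>n div p\<close>.\<close>
  define k where "k = n div p"
  have n: "n = p * k + n mod p"
    by (simp add: k_def)
  have n': "absp (fact n :: 'a) = absp (fact k :: 'a) / real p ^ k"
    using absp_fact_mult_add[of "n mod p" k] absp_fact_mult[of k] n p_gt_1 by simp
  show ?case
  proof (cases "k = 0")
    case True
    then show ?thesis
      using n' exp_radius_pos exp_radius_less_1 by (simp add: power_le_one)
  next
    case False
    then have "k < n"
      using p_gt_1 unfolding k_def
      by (metis div_eq_0_iff div_less_dividend gr0I div_0)
    have "p * k - 1 \<le> n - 1"
      using n by simp
    then have "exp_radius ^ (n - 1) \<le> exp_radius ^ (p * k - 1)"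
      using exp_radius_pos exp_radius_less_1 by (intro power_decreasing) auto
    \<comment> \<open>The part \<open>(p - 1) * k\<close> of the exponent contributes exactly
      \<open>1 / p ^ k\<close>, and \<open>k - 1\<close> is the exponent of the induction
      hypothesis.\<close>
    also have "p * k - 1 = (k - 1) + (p - 1) * k"
      using False p_gt_1 by (cases k; cases p) (auto simp: algebra_simps)
    also have "exp_radius ^ \<dots> = exp_radius ^ (k - 1) / real p ^ k"
      by (simp only: power_add power_mult exp_radius_power) (simp add: power_one_over)
    also have "\<dots> \<le> absp (fact n :: 'a)"
      unfolding n' using less.IH[OF \<open>k < n\<close>] by (intro divide_right_mono) auto
    finally show ?thesis .
  qed
qed

text \<open>Legendre's bound for \<open>Suc n\<close> has exponent \<open>n\<close>, so one factor
  \<open>absp z\<close> stays undivided by the radius. This gives the sharp estimate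
  \<open>absp (padic_exp z - 1) \<le> absp z\<close>.\<close>

lemma absp_exp_term_le:
  fixes z :: 'a
  shows "absp (z ^ Suc n / fact (Suc n)) \<le> absp z * (absp z / exp_radius) ^ n"
proof -
  have "absp (z ^ Suc n / fact (Suc n)) \<le> absp z ^ Suc n / exp_radius ^ n"
    unfolding absp_divide absp_power
    using absp_fact_ge[of "Suc n"] exp_radius_pos by (intro divide_left_mono) (auto simp del: fact_Suc)
  then show ?thesis
    by (simp add: power_divide)
qed

lemma absp_exp_term_le_power:
  fixes z :: 'a
  shows "absp (z ^ n / fact n) \<le> (absp z / exp_radius) ^ n"
proof (cases n)
  case (Suc k)
  have "absp z \<le> absp z / exp_radius"
    using exp_radius_pos exp_radius_less_1
    by (simp add: le_divide_eq mult_left_le)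
  then have "absp z * (absp z / exp_radius) ^ k \<le> (absp z / exp_radius) ^ Suc k"
    unfolding power_Suc using exp_radius_pos by (intro mult_right_mono) auto
  then show ?thesis
    unfolding Suc using absp_exp_term_le[of z k] by linarith
qed simp

text \<open>A factorial is at most its last factor in absolute value, so logarithm terms are
  dominated by exponential terms.\<close>

lemma absp_log_term_le:
  fixes u :: 'a
  shows "absp (u ^ Suc n / of_nat (Suc n)) \<le> absp u * (absp u / exp_radius) ^ n"
proof -
  have "absp (fact (Suc n) :: 'a) \<le> absp (of_nat (Suc n) :: 'a)"
    using absp_fact_le_1[of n]
    by (simp add: absp_mult mult_left_le del: of_nat_Suc)
  then have "absp (u ^ Suc n / of_nat (Suc n)) \<le> absp (u ^ Suc n / fact (Suc n))"
    unfolding absp_divide by (intro divide_left_mono) (auto simp del: of_nat_Suc fact_Suc)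
  then show ?thesis
    using absp_exp_term_le[of u n] by linarith
qed

section \<open>The exponential series, and binomial estimates for powers near 1\<close>

lemma padic_exp_sums:
  fixes z :: 'a
  assumes "absp z < exp_radius"
  shows "(\<lambda>n. z ^ n / fact n) sums padic_exp z"
  unfolding padic_exp_def
proof (rule sums_suminf_absp, rule tendsto_sandwich[OF _ _ tendsto_const])
  show "(\<lambda>n. (absp z / exp_radius) ^ n) \<longlonglongrightarrow> 0"
    using assms exp_radius_pos by (intro LIMSEQ_power_zero) simp
qed (use absp_exp_term_le_power in auto)

lemma absp_padic_exp_diff_le:
  fixes z :: 'a
  assumes "absp z < exp_radius"
  shows "absp (padic_exp z - 1) \<le> absp z"
    and "absp (padic_exp z - 1 - z) \<le> absp z * (absp z / exp_radius)"
proof -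
  have \<rho>: "0 \<le> absp z / exp_radius" "absp z / exp_radius \<le> 1"
    using assms exp_radius_pos by auto
  have "absp (z ^ n / fact n) \<le> absp z" if "n \<ge> 1" for n
  proof -
    obtain k where k: "n = Suc k"
      using \<open>n \<ge> 1\<close> by (cases n) auto
    have "absp z * (absp z / exp_radius) ^ k \<le> absp z"
      using \<rho> by (intro mult_left_le power_le_one) auto
    then show ?thesis
      unfolding k using absp_exp_term_le[of z k] by linarith
  qed
  then show "absp (padic_exp z - 1) \<le> absp z"
    using absp_sums_diff_le[OF padic_exp_sums[OF assms], of 1 "absp z"] by simp
  have "absp (z ^ n / fact n) \<le> absp z * (absp z / exp_radius)" if "n \<ge> 2" for n
  proof -
    obtain k where k: "n = Suc (Suc k)"
      using \<open>n \<ge> 2\<close> by (metis Suc_le_D numeral_2_eq_2 Suc_le_mono)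
    have "absp z * (absp z / exp_radius) ^ Suc k \<le> absp z * (absp z / exp_radius)"
      using \<rho> power_decreasing[of 1 "Suc k" "absp z / exp_radius"] by (intro mult_left_mono) auto
    then show ?thesis
      unfolding k using absp_exp_term_le[of z "Suc k"] by linarith
  qed
  then show "absp (padic_exp z - 1 - z) \<le> absp z * (absp z / exp_radius)"
    using absp_sums_diff_le[OF padic_exp_sums[OF assms], of 2 "absp z * (absp z / exp_radius)"]
      mult_nonneg_nonneg[OF absp_nonneg[of z] \<rho>(1)]
    by (simp add: numeral_2_eq_2 diff_diff_eq)
qed

lemma padic_exp_0 [simp]: "padic_exp (0::'a) = 1"
  using absp_padic_exp_diff_le(1)[of 0] exp_radius_pos absp_nonneg[of "padic_exp (0::'a) - 1"]
  by simp

text \<open>The product of the partial sums differs from the partial sum at \<open>a + b\<close>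
  only by terms with \<open>i + j \<ge> n\<close>. Each is at most \<open>\<rho> ^ n\<close> with
  \<open>\<rho> < 1\<close>, hence so is their sum.\<close>

lemma padic_exp_add:
  fixes a b :: 'a
  assumes a: "absp a < exp_radius" and b: "absp b < exp_radius"
  shows "padic_exp (a + b) = padic_exp a * padic_exp b"
proof -
  define \<rho> where "\<rho> = max (absp a) (absp b) / exp_radius"
  have \<rho>: "0 \<le> \<rho>" "\<rho> < 1"
    using a b exp_radius_pos by (auto simp: \<rho>_def le_max_iff_disj)
  have term_le: "absp (z ^ i / fact i) \<le> \<rho> ^ i" if "absp z \<le> max (absp a) (absp b)" for z :: 'a and i
  proof -
    have "(absp z / exp_radius) ^ i \<le> \<rho> ^ i"
      unfolding \<rho>_def using exp_radius_pos that by (intro power_mono divide_right_mono) auto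
    then show ?thesis
      using absp_exp_term_le_power[of z i] by linarith
  qed
  define A where "A n = (\<Sum>k<n. a ^ k / fact k)" for n
  define B where "B n = (\<Sum>k<n. b ^ k / fact k)" for n
  define C where "C n = (\<Sum>k<n. (a + b) ^ k / fact k)" for n
  have A: "A \<longlonglongrightarrow> padic_exp a" and B: "B \<longlonglongrightarrow> padic_exp b"
    and C: "C \<longlonglongrightarrow> padic_exp (a + b)"
    using padic_exp_sums[OF a] padic_exp_sums[OF b] padic_exp_sums[OF absp_add_less[OF a b]]
    by (simp_all add: sums_def A_def[abs_def] B_def[abs_def] C_def[abs_def])
  have "absp (A n * B n - C n - 0) \<le> \<rho> ^ n" for n
  proof -
    let ?f = "\<lambda>(i,j). (a ^ i / fact i) * (b ^ j / fact j)"
    have "A n * B n = sum ?f ({..<n} \<times> {..<n})"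
      by (simp add: A_def B_def sum_product sum.cartesian_product)
    moreover have "{(i,j). i + j < n} \<subseteq> {..<n} \<times> {..<n}"
      by auto
    ultimately have "A n * B n - C n = sum ?f ({..<n} \<times> {..<n} - {(i,j). i + j < n})"
      unfolding C_def exp_partial_sum_add
      by (subst sum_diff) auto
    moreover have "absp (?f ij) \<le> \<rho> ^ n"
      if "ij \<in> {..<n} \<times> {..<n} - {(i,j). i + j < n}" for ij
    proof -
      obtain i j where ij: "ij = (i, j)" "n \<le> i + j"
        using \<open>ij \<in> _\<close> by (cases ij) auto
      have "absp (?f ij) \<le> \<rho> ^ i * \<rho> ^ j"
        unfolding ij(1) prod.case absp_mult using \<rho> term_le by (intro mult_mono) auto
      also have "\<dots> \<le> \<rho> ^ n"
        using \<rho> ij(2) by (auto simp flip: power_add intro: power_decreasing)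
      finally show ?thesis .
    qed
    ultimately show ?thesis
      using \<rho> by (auto intro!: absp_sum_le)
  qed
  then have "(\<lambda>n. A n * B n - C n) \<longlonglongrightarrow> 0"
    by (rule tendstoI_absp) (use \<rho> in \<open>auto intro: LIMSEQ_power_zero\<close>)
  moreover have "(\<lambda>n. A n * B n - C n) \<longlonglongrightarrow> padic_exp a * padic_exp b - padic_exp (a + b)"
    by (intro tendsto_diff_absp tendsto_mult_absp A B C)
  ultimately show ?thesis
    using LIMSEQ_unique by fastforce
qed

lemma padic_exp_of_nat_mult:
  fixes z :: 'a
  assumes "absp z < exp_radius"
  shows "padic_exp (of_nat n * z) = padic_exp z ^ n"
proof (induction n)
  case (Suc n)
  have "absp (of_nat n * z) \<le> absp z"
    by (simp add: absp_mult mult_left_le_one_le)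
  then have "absp (of_nat n * z) < exp_radius"
    using assms by linarith
  then show ?case
    using Suc padic_exp_add[OF assms] by (simp add: distrib_right)
qed simp

text \<open>In the expansion of \<open>(1 + u) ^ n - 1\<close> over \<open>n\<close> the term
  \<open>u\<close> strictly dominates all others. Later this makes the logarithm preserve the
  distance to 1 and excludes nontrivial roots of unity near 1.\<close>

lemma absp_power_minus_one:
  fixes u :: 'a
  assumes "absp u < exp_radius"
  shows "absp ((1 + u) ^ n - 1) = absp (of_nat n :: 'a) * absp u"
proof (cases "n = 0 \<or> u = 0")
  case False
  then obtain n' where n': "n = Suc n'"
    by (cases n) auto
  have \<rho>: "0 \<le> absp u / exp_radius" "absp u / exp_radius < 1"
    using assms exp_radius_pos by auto
  let ?t = "\<lambda>k. of_nat (n' choose k) * (u ^ Suc k / of_nat (Suc k))"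
  have "absp (?t (Suc k)) \<le> absp u * (absp u / exp_radius)" for k
  proof -
    have "absp (?t (Suc k)) \<le> absp (u ^ Suc (Suc k) / of_nat (Suc (Suc k)))"
      unfolding absp_mult[of "of_nat _"] by (intro mult_left_le_one_le) auto
    also have "\<dots> \<le> absp u * (absp u / exp_radius) ^ Suc k"
      by (rule absp_log_term_le)
    also have "\<dots> \<le> absp u * (absp u / exp_radius)"
      using \<rho> power_decreasing[of 1 "Suc k" "absp u / exp_radius"] by (intro mult_left_mono) auto
    finally show ?thesis .
  qed
  then have "absp (\<Sum>k<n'. ?t (Suc k)) \<le> absp u * (absp u / exp_radius)"
    using \<rho>(1) by (intro absp_sum_le mult_nonneg_nonneg) auto
  also have "\<dots> < absp u"
    using \<rho> False by (metis absp_pos_iff mult.right_neutral mult_strict_left_mono)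
  finally have "absp (u + (\<Sum>k<n'. ?t (Suc k))) = absp u"
    by (rule absp_add_eq)
  moreover have "(\<Sum>k<n. ?t k) = u + (\<Sum>k<n'. ?t (Suc k))"
    unfolding n' sum.lessThan_Suc_shift by simp
  ultimately show ?thesis
    unfolding binomial_minus_one_expansion n' by (simp add: absp_mult del: of_nat_Suc)
qed auto

text \<open>By Pascal's rule \<open>n choose k\<close> changes sign from \<open>k\<close> to
  \<open>Suc k\<close> up to \<open>Suc n choose Suc k\<close>, which is divisible by
  \<open>Suc n\<close> apart from the denominator \<open>Suc k\<close>. These denominators
  accumulate to at worst \<open>k!\<close>.\<close>

lemma absp_binomial_alternating:
  "absp (of_nat (n choose k) - (-1) ^ k :: 'a) \<le> absp (of_nat (Suc n) :: 'a) / absp (fact k :: 'a)"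
proof (induction k)
  case (Suc k)
  let ?B = "absp (of_nat (Suc n) :: 'a) / absp (fact (Suc k) :: 'a)"
  have fact_le: "absp (fact (Suc k) :: 'a) \<le> absp (fact k :: 'a)"
      "absp (fact (Suc k) :: 'a) \<le> absp (of_nat (Suc k) :: 'a)"
    by (auto simp: absp_mult mult_left_le mult_left_le_one_le simp del: of_nat_Suc)
  have "(of_nat (Suc k) * of_nat (Suc n choose Suc k) :: 'a) = of_nat (Suc n) * of_nat (n choose k)"
    using Suc_times_binomial[of k n] by (simp only: flip: of_nat_mult)
  then have "of_nat (Suc n choose Suc k) = (of_nat (Suc n) * of_nat (n choose k) / of_nat (Suc k) :: 'a)"
    by (simp add: field_simps del: of_nat_Suc binomial_Suc_Suc)
  then have "absp (of_nat (Suc n choose Suc k) :: 'a)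
      \<le> absp (of_nat (Suc n) :: 'a) / absp (of_nat (Suc k) :: 'a)"
    by (simp add: absp_divide absp_mult divide_right_mono mult_left_le del: of_nat_Suc binomial_Suc_Suc)
  also have "\<dots> \<le> ?B"
    using fact_le by (intro divide_left_mono) (auto simp del: of_nat_Suc fact_Suc)
  finally have 1: "absp (of_nat (Suc n choose Suc k) :: 'a) \<le> ?B" .
  have "absp (of_nat (Suc n) :: 'a) / absp (fact k :: 'a) \<le> ?B"
    using fact_le by (intro divide_left_mono) (auto simp del: of_nat_Suc fact_Suc)
  then have 2: "absp (of_nat (n choose k) - (-1) ^ k :: 'a) \<le> ?B"
    using Suc by linarith
  have "of_nat (n choose Suc k) - (-1) ^ Suc k =
      (of_nat (Suc n choose Suc k) - (of_nat (n choose k) - (-1) ^ k) :: 'a)"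
    by simp
  then show ?case
    using absp_diff_le[OF 1 2] by simp
qed simp

section \<open>The logarithm as a limit over exponents \<open>p ^ N\<close>\<close>

lemma absp_of_nat_p_power: "absp (of_nat (p ^ N) :: 'a) = (1 / real p) ^ N"
  by (simp add: absp_power absp_p)

lemma inverse_p_power_tendsto_0: "(\<lambda>N. (1 / real p) ^ N) \<longlonglongrightarrow> 0"
  using p_gt_1 by (intro LIMSEQ_power_zero) simp

lemma p_power_nonzero [simp]: "(of_nat (p ^ N) :: 'a) \<noteq> 0"
  using p_gt_1 by simp

text \<open>Describing the logarithm as the limit of \<open>(a\<^sup>M - 1) / M\<close> for \<open>M = p\<^sup>N\<close> gives its functional
  equation and its values on the image of \<open>padic_exp\<close> without composing power series.\<close>

lemma padic_log_limit:
  fixes a :: 'a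
  assumes "absp (a - 1) < exp_radius"
  shows "(\<lambda>N. (a ^ (p ^ N) - 1) / of_nat (p ^ N)) \<longlonglongrightarrow> padic_log a"
proof -
  define u where "u = a - 1"
  have u: "absp u < exp_radius" and a: "a = 1 + u"
    using assms by (simp_all add: u_def)
  have \<rho>: "0 \<le> absp u / exp_radius" "absp u / exp_radius < 1"
    using u exp_radius_pos by auto
  let ?t = "\<lambda>k. (-1) ^ k * u ^ Suc k / of_nat (Suc k)"
  have term_eq: "absp (?t n) = absp (u ^ Suc n / of_nat (Suc n))" for n
    by (simp only: absp_divide absp_mult absp_neg_one_power mult_1)
  have "(\<lambda>n. absp u * (absp u / exp_radius) ^ n) \<longlonglongrightarrow> absp u * 0"
    using \<rho> by (intro tendsto_intros LIMSEQ_power_zero) auto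
  then have zero: "(\<lambda>n. absp u * (absp u / exp_radius) ^ n) \<longlonglongrightarrow> 0"
    by simp
  have "(\<lambda>n. absp (?t n)) \<longlonglongrightarrow> 0"
  proof (rule tendsto_sandwich[OF _ _ tendsto_const zero])
    show "\<forall>\<^sub>F n in sequentially. 0 \<le> absp (?t n)"
      by (intro always_eventually allI absp_nonneg)
    show "\<forall>\<^sub>F n in sequentially. absp (?t n) \<le> absp u * (absp u / exp_radius) ^ n"
      unfolding term_eq by (intro always_eventually allI absp_log_term_le)
  qed
  then have "?t sums padic_log a"
    unfolding padic_log_def u_def[symmetric] by (rule sums_suminf_absp)
  then have partial: "(\<lambda>N. \<Sum>k<p ^ N. ?t k) \<longlonglongrightarrow> padic_log a"
    unfolding sums_def
    by (rule filterlim_compose) (use p_gt_1 in \<open>auto intro!: filterlim_subseq strict_monoI power_strict_increasing\<close>)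
  have bound: "absp ((a ^ M - 1) / of_nat M - (\<Sum>k<M. ?t k) - 0) \<le> absp (of_nat M :: 'a)" if "M > 0" for M
  proof -
    obtain n where n: "M = Suc n"
      using \<open>M > 0\<close> by (cases M) auto
    have "(a ^ M - 1) / of_nat M - (\<Sum>k<M. ?t k) =
        (\<Sum>k<M. (of_nat (n choose k) - (-1) ^ k) * (u ^ Suc k / of_nat (Suc k)))"
      unfolding a binomial_minus_one_expansion n
      by (simp add: left_diff_distrib diff_divide_distrib flip: sum_subtractf
          del: of_nat_Suc sum.lessThan_Suc)
    moreover have "absp ((of_nat (n choose k) - (-1) ^ k) * (u ^ Suc k / of_nat (Suc k)))
        \<le> absp (of_nat M :: 'a)" for k
    proof -
      have "absp ((of_nat (n choose k) - (-1) ^ k) * (u ^ Suc k / of_nat (Suc k)))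
          \<le> absp (of_nat M :: 'a) / absp (fact k :: 'a) * absp (u ^ Suc k / of_nat (Suc k))"
        unfolding absp_mult n by (intro mult_right_mono absp_binomial_alternating) auto
      \<comment> \<open>The denominator \<open>k!\<close> of the binomial estimate merges with
        \<open>Suc k\<close> into \<open>fact (Suc k)\<close>, leaving an exponential term, which is
        at most 1.\<close>
      also have "\<dots> = absp (of_nat M :: 'a) * absp (u ^ Suc k / fact (Suc k))"
        by (simp add: absp_divide absp_mult del: of_nat_Suc)
      also have "\<dots> \<le> absp (of_nat M :: 'a)"
      proof (rule mult_left_le)
        show "absp (u ^ Suc k / fact (Suc k)) \<le> 1"
          using absp_exp_term_le_power[of u "Suc k"] power_le_one[of "absp u / exp_radius" "Suc k"] \<rho>
          by linarith
      qed simp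
      finally show ?thesis .
    qed
    ultimately show ?thesis
      by (auto intro!: absp_sum_le)
  qed
  have "absp ((a ^ (p ^ N) - 1) / of_nat (p ^ N) - (\<Sum>k<p ^ N. ?t k) - 0) \<le> (1 / real p) ^ N" for N
    unfolding absp_of_nat_p_power[symmetric] by (rule bound) (use p_gt_1 in simp)
  then have "(\<lambda>N. (a ^ (p ^ N) - 1) / of_nat (p ^ N) - (\<Sum>k<p ^ N. ?t k)) \<longlonglongrightarrow> 0"
    by (rule tendstoI_absp) (rule inverse_p_power_tendsto_0)
  from tendsto_add_absp[OF this partial] show ?thesis
    by simp
qed

text \<open>By \<open>absp_power_minus_one\<close> the quotients converging to the logarithm all
  have absolute value \<open>absp (a - 1)\<close>.\<close>

lemma absp_padic_log:
  fixes a :: 'a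
  assumes "absp (a - 1) < exp_radius"
  shows "absp (padic_log a) = absp (a - 1)"
proof (rule LIMSEQ_unique)
  show "(\<lambda>N. absp ((a ^ (p ^ N) - 1) / of_nat (p ^ N))) \<longlonglongrightarrow> absp (padic_log a)"
    by (intro tendsto_absp padic_log_limit assms)
  have "absp ((a ^ (p ^ N) - 1) / of_nat (p ^ N)) = absp (a - 1)" for N
    using absp_power_minus_one[OF assms, of "p ^ N"] p_power_nonzero[of N]
    by (simp add: absp_divide del: of_nat_power p_power_nonzero)
  then show "(\<lambda>N. absp ((a ^ (p ^ N) - 1) / of_nat (p ^ N))) \<longlonglongrightarrow> absp (a - 1)"
    by simp
qed

lemma absp_unit_ball:
  fixes a :: 'a
  assumes "absp (a - 1) < exp_radius"
  shows "absp a = 1"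
  using absp_add_eq[of "a - 1" 1] assms exp_radius_less_1 by simp

lemma unit_ball_mult:
  fixes a b :: 'a
  assumes "absp (a - 1) < exp_radius" "absp (b - 1) < exp_radius"
  shows "absp (a * b - 1) < exp_radius"
proof -
  have "a * b - 1 = a * (b - 1) + (a - 1)"
    by (simp add: algebra_simps)
  then show ?thesis
    using absp_add_less[of "a * (b - 1)" exp_radius "a - 1"] assms absp_unit_ball[of a]
    by (simp only: absp_mult mult_1)
qed

lemma unit_ball_power:
  fixes a :: 'a
  assumes "absp (a - 1) < exp_radius"
  shows "absp (a ^ n - 1) < exp_radius"
  using exp_radius_pos by (induction n) (simp_all add: unit_ball_mult[OF assms])

lemma power_p_power_tendsto_1:
  fixes a :: 'a
  assumes "absp (a - 1) < exp_radius"
  shows "(\<lambda>N. a ^ (p ^ N)) \<longlonglongrightarrow> 1"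
proof (rule tendstoI_absp)
  show "absp (a ^ (p ^ N) - 1) \<le> (1 / real p) ^ N" for N
    using absp_power_minus_one[OF assms, of "p ^ N"] absp_of_nat_p_power[of N] assms
      exp_radius_less_1 by (simp add: mult_left_le)
qed (rule inverse_p_power_tendsto_0)

text \<open>Divide \<open>(a * b) ^ M - 1 = (a ^ M - 1) * b ^ M + (b ^ M - 1)\<close> by
  \<open>M = p ^ N\<close> and use that \<open>b ^ M\<close> tends to 1.\<close>

lemma padic_log_mult:
  fixes a b :: 'a
  assumes "absp (a - 1) < exp_radius" "absp (b - 1) < exp_radius"
  shows "padic_log (a * b) = padic_log a + padic_log b"
proof (rule LIMSEQ_unique)
  show "(\<lambda>N. ((a * b) ^ (p ^ N) - 1) / of_nat (p ^ N)) \<longlonglongrightarrow> padic_log (a * b)"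
    by (intro padic_log_limit unit_ball_mult assms)
  have "(\<lambda>N. (a ^ (p ^ N) - 1) / of_nat (p ^ N) * b ^ (p ^ N) + (b ^ (p ^ N) - 1) / of_nat (p ^ N))
      \<longlonglongrightarrow> padic_log a * 1 + padic_log b"
    by (intro tendsto_add_absp tendsto_mult_absp padic_log_limit power_p_power_tendsto_1 assms)
  moreover have "(a ^ M - 1) / of_nat M * b ^ M + (b ^ M - 1) / of_nat M
      = ((a * b) ^ M - 1) / of_nat M" for M
    by (simp add: power_mult_distrib left_diff_distrib flip: add_divide_distrib)
  ultimately show "(\<lambda>N. ((a * b) ^ (p ^ N) - 1) / of_nat (p ^ N)) \<longlonglongrightarrow> padic_log a + padic_log b"
    by (simp only: mult_1_right)
qed

lemma padic_log_1 [simp]: "padic_log (1::'a) = 0"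
  using absp_padic_log[of 1] exp_radius_pos by simp

lemma padic_log_power:
  fixes a :: 'a
  assumes "absp (a - 1) < exp_radius"
  shows "padic_log (a ^ n) = of_nat n * padic_log a"
  by (induction n) (simp_all add: padic_log_mult assms unit_ball_power distrib_right)

text \<open>Since \<open>padic_exp z ^ M = padic_exp (M * z)\<close> is \<open>1 + M * z\<close> up
  to an error of order \<open>M ^ 2\<close>, the quotient in the logarithm limit is \<open>z\<close>
  up to order \<open>M\<close>.\<close>

lemma padic_log_exp:
  fixes z :: 'a
  assumes z: "absp z < exp_radius"
  shows "padic_log (padic_exp z) = z"
proof (rule LIMSEQ_unique)
  have e: "absp (padic_exp z - 1) < exp_radius"
    using absp_padic_exp_diff_le(1)[OF z] z by linarith
  show "(\<lambda>N. (padic_exp z ^ (p ^ N) - 1) / of_nat (p ^ N)) \<longlonglongrightarrow> padic_log (padic_exp z)"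
    by (rule padic_log_limit[OF e])
  show "(\<lambda>N. (padic_exp z ^ (p ^ N) - 1) / of_nat (p ^ N)) \<longlonglongrightarrow> z"
  proof (rule tendstoI_absp)
    fix N
    define M :: 'a where "M = of_nat (p ^ N)"
    have M: "M \<noteq> 0" "absp M \<le> 1"
      unfolding M_def using p_power_nonzero absp_of_nat_le_1 by blast+
    have le: "absp (M * z) \<le> absp z"
      using M by (simp add: absp_mult mult_left_le_one_le)
    then have "absp (padic_exp (M * z) - 1 - M * z) \<le> absp (M * z) * (absp (M * z) / exp_radius)"
      using z by (intro absp_padic_exp_diff_le) linarith
    also have "\<dots> \<le> absp (M * z) * absp M"
      using z exp_radius_pos
      by (intro mult_left_mono) (auto simp: absp_mult divide_le_eq mult_left_mono)
    also have "\<dots> \<le> absp M * absp M"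
      using z exp_radius_less_1 by (intro mult_right_mono) (auto simp: absp_mult mult_left_le)
    finally have "absp ((padic_exp (M * z) - 1 - M * z) / M) \<le> absp M"
      using M by (simp add: absp_divide divide_le_eq)
    moreover have "(padic_exp (M * z) - 1 - M * z) / M = (padic_exp z ^ (p ^ N) - 1) / M - z"
      using M padic_exp_of_nat_mult[OF z, of "p ^ N"]
      by (simp add: M_def[symmetric] diff_divide_distrib del: of_nat_power)
    ultimately show "absp ((padic_exp z ^ (p ^ N) - 1) / of_nat (p ^ N) - z) \<le> (1 / real p) ^ N"
      by (simp only: M_def absp_of_nat_p_power)
  qed (rule inverse_p_power_tendsto_0)
qed

text \<open>The logarithm is injective near 1 because it preserves the distance to 1. Both
  \<open>a\<close> and \<open>padic_exp (padic_log a)\<close> have the same logarithm, so their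
  quotient \<open>c\<close> is 1.\<close>

lemma padic_exp_log:
  fixes a :: 'a
  assumes a: "absp (a - 1) < exp_radius"
  shows "padic_exp (padic_log a) = a"
proof -
  define e where "e = padic_exp (padic_log a)"
  have L: "absp (padic_log a) < exp_radius"
    using a absp_padic_log[OF a] by simp
  have e: "absp (e - 1) < exp_radius"
    using absp_padic_exp_diff_le(1)[OF L] L by (simp add: e_def)
  define c where "c = e / a"
  have nz: "a \<noteq> 0" and a1: "absp a = 1"
    using absp_unit_ball[OF a] by auto
  have "c - 1 = ((e - 1) + (1 - a)) / a"
    using nz by (simp add: c_def field_simps)
  then have c: "absp (c - 1) < exp_radius"
    using absp_add_less[of "e - 1" exp_radius "1 - a"] e a a1
    by (simp add: absp_divide absp_minus_commute)
  have "padic_log e = padic_log c + padic_log a"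
    using padic_log_mult[OF c a] nz by (simp add: c_def)
  moreover have "padic_log e = padic_log a"
    using padic_log_exp[OF L] by (simp add: e_def)
  ultimately have "c = 1"
    using absp_padic_log[OF c] by simp
  then show ?thesis
    using nz by (simp add: c_def e_def)
qed

section \<open>Powers with \<open>p\<close>-adic exponents\<close>

lemma qpow_argument_bound:
  fixes q x :: 'a
  assumes "absp (q - 1) < exp_radius" and "absp x \<le> 1"
  shows "absp (x * padic_log q) \<le> absp x * absp (q - 1)" "absp (x * padic_log q) < exp_radius"
proof -
  show *: "absp (x * padic_log q) \<le> absp x * absp (q - 1)"
    using absp_padic_log[OF assms(1)] by (simp add: absp_mult)
  also have "\<dots> \<le> absp (q - 1)"
    using assms(2) by (intro mult_left_le_one_le) auto
  finally show "absp (x * padic_log q) < exp_radius"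
    using assms(1) by linarith
qed

lemma qpow_add:
  fixes q x y :: 'a
  assumes "absp (q - 1) < exp_radius" and "absp x \<le> 1" and "absp y \<le> 1"
  shows "qpow q (x + y) = qpow q x * qpow q y"
  unfolding qpow_def distrib_right
  by (intro padic_exp_add qpow_argument_bound assms)

lemma qpow_of_nat:
  fixes q :: 'a
  assumes "absp (q - 1) < exp_radius"
  shows "qpow q (of_nat n) = q ^ n"
  unfolding qpow_def
  using assms absp_padic_log[OF assms] by (simp add: padic_exp_of_nat_mult padic_exp_log)

lemma qpow_power_base:
  fixes q x :: 'a
  assumes "absp (q - 1) < exp_radius"
  shows "qpow (q ^ l) x = qpow q (of_nat l * x)"
  unfolding qpow_def padic_log_power[OF assms] by (simp add: ac_simps)

text \<open>This is the source of the Lipschitz constant 1 in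
  \<open>padic_lipschitz_qpow\<close>.\<close>

lemma absp_qpow_minus_1_le:
  fixes q x :: 'a
  assumes "absp (q - 1) < exp_radius" and "absp x \<le> 1"
  shows "absp (qpow q x - 1) \<le> absp x"
proof -
  have "absp (qpow q x - 1) \<le> absp (x * padic_log q)"
    unfolding qpow_def by (intro absp_padic_exp_diff_le qpow_argument_bound assms)
  also have "\<dots> \<le> absp x * absp (q - 1)"
    by (intro qpow_argument_bound assms)
  also have "\<dots> \<le> absp x"
    using assms(1) exp_radius_less_1 by (intro mult_left_le) auto
  finally show ?thesis .
qed

lemma absp_qpow_le_1:
  fixes q x :: 'a
  assumes "absp (q - 1) < exp_radius" and "absp x \<le> 1"
  shows "absp (qpow q x) \<le> 1"
  using absp_add_le[of "qpow q x - 1" 1 1] absp_qpow_minus_1_le[OF assms] assms(2) by simp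

lemma power_eq_1_iff_unit_ball:
  fixes q :: 'a
  assumes "absp (q - 1) < exp_radius" and "l > 0"
  shows "q ^ l = 1 \<longleftrightarrow> q = 1"
  using absp_power_minus_one[OF assms(1), of l] assms(2) by auto

text \<open>The factor \<open>1 - q ^ l\<close> cancels. The conventions for base 1 take effect
  simultaneously in all three brackets, because \<open>q ^ l = 1\<close> only for
  \<open>q = 1\<close>.\<close>

lemma qbracket_mult:
  fixes q y :: 'a
  assumes q: "absp (q - 1) < exp_radius" and l: "l > 0"
  shows "qbracket q 1 (of_nat l) * qbracket q l y = qbracket q 1 (of_nat l * y)"
  using power_eq_1_iff_unit_ball[OF q l] by (simp add: qbracket_def qpow_of_nat[OF q])

section \<open>Lipschitz sequences and fermionic integrals\<close>

text \<open>Lipschitz continuity on the natural numbers, dense in the \<open>p\<close>-adic integers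
  and the only points that the integral samples.\<close>

definition padic_lipschitz :: "(nat \<Rightarrow> 'a) \<Rightarrow> bool" where
  "padic_lipschitz F \<longleftrightarrow> (\<exists>C. \<forall>n k. absp (F (n + k) - F n) \<le> C * absp (of_nat k :: 'a))"

lemma padic_lipschitzE:
  assumes "padic_lipschitz F"
  obtains C where "C \<ge> 0" "\<And>n k. absp (F (n + k) - F n) \<le> C * absp (of_nat k :: 'a)"
    "\<And>n. absp (F n) \<le> C"
proof -
  obtain C where C: "\<And>n k. absp (F (n + k) - F n) \<le> C * absp (of_nat k :: 'a)"
    using assms unfolding padic_lipschitz_def by blast
  \<comment> \<open>Including \<open>absp (F 0)\<close> makes one constant also bound all values,
    since every \<open>n\<close> is at distance at most 1 from 0.\<close>
  define D where "D = max 0 (max C (absp (F 0)))"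
  have lip: "absp (F (n + k) - F n) \<le> D * absp (of_nat k :: 'a)" for n k
    by (rule order_trans[OF C]) (auto simp: D_def intro: mult_right_mono)
  have "absp (F n) \<le> D" for n
  proof -
    have "absp (F n - F 0) \<le> D * absp (of_nat n :: 'a)"
      using lip[of 0 n] by simp
    also have "\<dots> \<le> D"
      by (intro mult_left_le) (auto simp: D_def)
    finally show ?thesis
      using absp_add_le[of "F n - F 0" D "F 0"] by (simp add: D_def)
  qed
  then show thesis
    using that[of D] lip by (simp add: D_def)
qed

lemma padic_lipschitz_mult:
  assumes "padic_lipschitz F" "padic_lipschitz G"
  shows "padic_lipschitz (\<lambda>n. F n * G n)"
proof -
  obtain C where C: "C \<ge> 0" "\<And>n k. absp (F (n + k) - F n) \<le> C * absp (of_nat k :: 'a)"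
    "\<And>n. absp (F n) \<le> C"
    using assms(1) by (elim padic_lipschitzE) blast
  obtain D where D: "D \<ge> 0" "\<And>n k. absp (G (n + k) - G n) \<le> D * absp (of_nat k :: 'a)"
    "\<And>n. absp (G n) \<le> D"
    using assms(2) by (elim padic_lipschitzE) blast
  have "absp (F (n + k) * G (n + k) - F n * G n) \<le> C * D * absp (of_nat k :: 'a)" for n k
  proof -
    have "absp (F (n + k) * (G (n + k) - G n)) \<le> C * (D * absp (of_nat k :: 'a))"
      unfolding absp_mult using C D by (intro mult_mono) auto
    moreover have "absp ((F (n + k) - F n) * G n) \<le> C * absp (of_nat k :: 'a) * D"
      unfolding absp_mult using C D by (intro mult_mono) auto
    moreover have "F (n + k) * G (n + k) - F n * G n =
        F (n + k) * (G (n + k) - G n) + (F (n + k) - F n) * G n"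
      by (simp add: algebra_simps)
    ultimately show ?thesis
      by (auto intro!: absp_add_le simp: mult_ac)
  qed
  then show ?thesis
    unfolding padic_lipschitz_def by blast
qed

lemma padic_lipschitz_power:
  assumes "padic_lipschitz F"
  shows "padic_lipschitz (\<lambda>n. F n ^ m)"
proof (induction m)
  case 0
  show ?case
    unfolding padic_lipschitz_def by (rule exI[of _ 0]) simp
next
  case (Suc m)
  then show ?case
    using padic_lipschitz_mult[OF assms] by simp
qed

lemma padic_lipschitz_qpow:
  fixes q a b :: 'a
  assumes q: "absp (q - 1) < exp_radius" and a: "absp a \<le> 1" and b: "absp b \<le> 1"
  shows "padic_lipschitz (\<lambda>n. qpow q (a + b * of_nat n))"
proof -
  have "absp (qpow q (a + b * of_nat (n + k)) - qpow q (a + b * of_nat n)) \<le> 1 * absp (of_nat k :: 'a)"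
    for n k
  proof -
    have bn: "absp (b * of_nat n) \<le> absp (of_nat n :: 'a)" for n
      unfolding absp_mult using b by (intro mult_left_le_one_le) auto
    then have bn1: "absp (b * of_nat n) \<le> 1" for n
      using absp_of_nat_le_1 order_trans by blast
    have abn: "absp (a + b * of_nat n) \<le> 1"
      using a bn1 by (intro absp_add_le)
    have "qpow q (a + b * of_nat (n + k)) = qpow q (a + b * of_nat n) * qpow q (b * of_nat k)"
      using qpow_add[OF q abn bn1] by (simp add: algebra_simps)
    then have "absp (qpow q (a + b * of_nat (n + k)) - qpow q (a + b * of_nat n)) =
        absp (qpow q (a + b * of_nat n)) * absp (qpow q (b * of_nat k) - 1)"
      by (simp add: right_diff_distrib flip: absp_mult)
    also have "\<dots> \<le> absp (qpow q (b * of_nat k) - 1)"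
      by (intro mult_left_le_one_le absp_qpow_le_1 q abn) auto
    also have "\<dots> \<le> absp (of_nat k :: 'a)"
      using absp_qpow_minus_1_le[OF q bn1] bn order_trans by blast
    finally show ?thesis by simp
  qed
  then show ?thesis
    unfolding padic_lipschitz_def by blast
qed

lemma padic_lipschitz_qbracket:
  fixes q y :: 'a
  assumes q: "absp (q - 1) < exp_radius" and y: "absp (of_nat l * y) \<le> 1"
  shows "padic_lipschitz (\<lambda>n. qbracket q l (y + of_nat n))"
proof (cases "q ^ l = 1")
  case True
  \<comment> \<open>Here the bracket is \<open>y + n\<close> itself, so the constant is 1.\<close>
  then show ?thesis
    unfolding padic_lipschitz_def qbracket_def by (intro exI[of _ 1]) simp
next
  case False
  obtain C where C: "\<And>n k. absp (qpow q (of_nat l * y + of_nat l * of_nat (n + k))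
      - qpow q (of_nat l * y + of_nat l * of_nat n)) \<le> C * absp (of_nat k :: 'a)"
    using padic_lipschitz_qpow[OF q y absp_of_nat_le_1] unfolding padic_lipschitz_def by blast
  have "absp (qbracket q l (y + of_nat (n + k)) - qbracket q l (y + of_nat n))
      \<le> C / absp (1 - q ^ l) * absp (of_nat k :: 'a)" for n k
  proof -
    have "qbracket q l (y + of_nat (n + k)) - qbracket q l (y + of_nat n) =
        - (qpow q (of_nat l * y + of_nat l * of_nat (n + k))
          - qpow q (of_nat l * y + of_nat l * of_nat n)) / (1 - q ^ l)"
      using False by (simp add: qbracket_def distrib_left flip: diff_divide_distrib)
    then show ?thesis
      using divide_right_mono[OF C[of n k], of "absp (1 - q ^ l)"] by (simp only: absp_divide absp_minus) simp
  qed
  then show ?thesis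
    unfolding padic_lipschitz_def by blast
qed

section \<open>Alternating sums and their limits along odd multiples of \<open>p ^ N\<close>\<close>

definition alternating_sum :: "(nat \<Rightarrow> 'a) \<Rightarrow> nat \<Rightarrow> 'a" where
  "alternating_sum F n = (\<Sum>x<n. (-1) ^ x * F x)"

text \<open>For odd block length \<open>M\<close> a shift by \<open>j * M\<close> changes the sign
  by \<open>(-1) ^ j\<close>. It is used with \<open>M = p ^ N\<close> to compare blocks and with
  \<open>M = l\<close> to sort indices by residue.\<close>

lemma alternating_sum_mult:
  assumes "odd M"
  shows "alternating_sum F (l * M) = (\<Sum>j<l. \<Sum>x<M. (-1) ^ j * ((-1) ^ x * F (x + j * M)))"
proof -
  have "alternating_sum F (l * M) = (\<Sum>j<l. \<Sum>x<M. (-1) ^ (x + j * M) * F (x + j * M))"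
    unfolding alternating_sum_def
    by (subst sum.nat_group[symmetric])
      (simp add: sum.shift_bounds_nat_ivl[of _ 0, simplified] add.commute lessThan_atLeast0)
  moreover have "(-1) ^ (x + j * M) = ((-1) ^ j * (-1) ^ x :: 'a)" for x j
    using assms by (simp add: uminus_power_if)
  ultimately show ?thesis
    by (simp only: mult.assoc)
qed

text \<open>Cutting \<open>{..<l * p\<^sup>N}\<close> into \<open>l\<close> blocks, whose signs alternate because \<open>p\<close> is odd, all blocks but
  one cancel up to an error of size \<open>p\<^sup>-\<^sup>N\<close>.\<close>

lemma alternating_sum_blocks:
  assumes F: "padic_lipschitz F" and "odd p"
  obtains C where "\<And>l N. odd l \<Longrightarrow>
    absp (alternating_sum F (l * p ^ N) - alternating_sum F (p ^ N)) \<le> C * (1 / real p) ^ N"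
proof -
  obtain C where C: "C \<ge> 0" "\<And>n k. absp (F (n + k) - F n) \<le> C * absp (of_nat k :: 'a)"
    using F by (elim padic_lipschitzE) blast
  have "absp (alternating_sum F (l * p ^ N) - alternating_sum F (p ^ N)) \<le> C * (1 / real p) ^ N"
    if "odd l" for l N
  proof -
    let ?M = "p ^ N"
    have oddM: "odd ?M"
      using \<open>odd p\<close> by simp
    \<comment> \<open>As \<open>l\<close> is odd, the signs \<open>(-1) ^ j\<close> sum to 1, so one
      block may be written as \<open>l\<close> signed copies and compared termwise.\<close>
    have single: "alternating_sum F ?M = (\<Sum>j<l. \<Sum>x<?M. (-1) ^ j * ((-1) ^ x * F x))"
      using sum_neg_one_power_odd[OF that, where ?'b = 'a]
      by (simp add: alternating_sum_def flip: sum_distrib_left sum_distrib_right)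
    have "absp ((-1) ^ j * ((-1) ^ x * (F (x + j * ?M) - F x))) \<le> C * (1 / real p) ^ N" for j x
    proof -
      have "absp (of_nat (j * ?M) :: 'a) \<le> (1 / real p) ^ N"
        unfolding of_nat_mult absp_mult absp_of_nat_p_power
        by (intro mult_left_le_one_le) auto
      then have "C * absp (of_nat (j * ?M) :: 'a) \<le> C * (1 / real p) ^ N"
        using C(1) by (intro mult_left_mono)
      then show ?thesis
        using C(2)[of x "j * ?M"] by (simp add: absp_mult)
    qed
    moreover have "alternating_sum F (l * ?M) - alternating_sum F ?M =
        (\<Sum>j<l. \<Sum>x<?M. (-1) ^ j * ((-1) ^ x * (F (x + j * ?M) - F x)))"
      unfolding alternating_sum_mult[OF oddM] single by (simp add: sum_subtractf right_diff_distrib)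
    ultimately show ?thesis
      using C(1) by (auto intro!: absp_sum_le)
  qed
  then show thesis by (rule that)
qed

lemma alternating_sum_converges:
  assumes F: "padic_lipschitz F" and "odd p"
  obtains L where "\<And>l. odd l \<Longrightarrow> (\<lambda>N. alternating_sum F (l * p ^ N)) \<longlonglongrightarrow> L"
proof -
  obtain C where C: "\<And>l N. odd l \<Longrightarrow>
    absp (alternating_sum F (l * p ^ N) - alternating_sum F (p ^ N)) \<le> C * (1 / real p) ^ N"
    using alternating_sum_blocks[OF assms] by blast
  have zero: "(\<lambda>N. C * (1 / real p) ^ N) \<longlonglongrightarrow> 0"
    using tendsto_mult_left[OF inverse_p_power_tendsto_0, of C] by simp
  \<comment> \<open>For \<open>l = p\<close> the block estimate compares consecutive members of the
    sequence.\<close>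
  have "convergent (\<lambda>N. alternating_sum F (p ^ N))"
    using C[OF \<open>odd p\<close>]
    by (intro convergent_absp tendsto_sandwich[OF _ _ tendsto_const zero]) auto
  then obtain L where L: "(\<lambda>N. alternating_sum F (p ^ N)) \<longlonglongrightarrow> L"
    by (auto simp: convergent_def)
  have "(\<lambda>N. alternating_sum F (l * p ^ N)) \<longlonglongrightarrow> L" if "odd l" for l
  proof -
    have "(\<lambda>N. alternating_sum F (l * p ^ N) - alternating_sum F (p ^ N)) \<longlonglongrightarrow> 0"
      using C[OF that] by (intro tendstoI_absp[OF _ zero]) simp
    from tendsto_add_absp[OF this L] show ?thesis
      by simp
  qed
  then show thesis by (rule that)
qed

section \<open>Evaluation of the fermionic integral and the multiplication formula\<close>

lemma absp_2: "odd p \<Longrightarrow> absp (2 :: 'a) = 1"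
  using absp_of_nat_not_dvd[of 2] p_gt_1 primes_dvd_imp_eq[OF prime_p two_is_prime_nat] by auto

text \<open>Otherwise \<open>a - 1 = -2\<close>, which has absolute value 1 for odd
  \<open>p\<close>. This keeps the denominators \<open>1 + Q ^ (p ^ N)\<close> and
  \<open>qtwo (q ^ l)\<close> away from 0.\<close>

lemma one_plus_unit_ball_nonzero:
  fixes a :: 'a
  assumes "odd p" "absp (a - 1) < exp_radius"
  shows "1 + a \<noteq> 0"
proof
  assume "1 + a = 0"
  then have "a - 1 = -2"
    by (simp add: eq_neg_iff_add_eq_0 algebra_simps)
  then show False
    using assms(2) absp_2[OF assms(1)] exp_radius_less_1 by (simp only: absp_minus)
qed

text \<open>The normalising factor tends to \<open>qtwo Q / 2\<close> because
  \<open>Q ^ (p ^ N)\<close> tends to 1.\<close>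

lemma fermionic_integral_eq:
  fixes Q :: 'a
  assumes "odd p" and Q: "absp (Q - 1) < exp_radius"
    and L: "(\<lambda>N. alternating_sum (\<lambda>n. f (of_nat n) * qpow Q (of_nat n)) (p ^ N)) \<longlonglongrightarrow> L"
  shows "fermionic_integral p Q f = qtwo Q / 2 * L"
proof -
  have "(\<lambda>N. 1 / (1 + Q ^ (p ^ N))) \<longlonglongrightarrow> 1 / (1 + 1)"
    by (intro tendsto_inverse_absp tendsto_add_absp tendsto_const power_p_power_tendsto_1[OF Q]
        one_plus_unit_ball_nonzero \<open>odd p\<close> unit_ball_power[OF Q]) (simp add: exp_radius_pos)
  from tendsto_cmult_absp[OF tendsto_mult_absp[OF this L], of "qtwo Q"]
  have "(\<lambda>N. qtwo Q / (1 + qpow Q (of_nat (p ^ N))) *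
      (\<Sum>x<p ^ N. f (of_nat x) * (-1) ^ x * qpow Q (of_nat x))) \<longlonglongrightarrow> qtwo Q / 2 * L"
    unfolding qpow_of_nat[OF Q] alternating_sum_def by (simp add: mult_ac)
  then show ?thesis
    unfolding fermionic_integral_def by (rule limI)
qed

lemma qEuler_integrand_lipschitz:
  fixes q y :: 'a
  assumes q: "absp (q - 1) < exp_radius" and y: "absp (of_nat l * y) \<le> 1"
  shows "padic_lipschitz (\<lambda>n. qbracket q l (y + of_nat n) ^ m *
    qpow (q ^ l) (of_int (h - 1) * of_nat n) * qpow (q ^ l) (of_nat n))"
proof -
  have "padic_lipschitz (\<lambda>n. qpow (q ^ l) (0 + c * of_nat n))" if "absp c \<le> 1" for c :: 'a
    by (intro padic_lipschitz_qpow unit_ball_power q that) simp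
  from this[of "of_int (h - 1)"] this[of 1] show ?thesis
    by (intro padic_lipschitz_mult padic_lipschitz_power padic_lipschitz_qbracket q y)
      (simp_all del: of_int_diff)
qed

text \<open>Stated for the closed unit ball, so that it applies to \<open>x\<close> and to
  \<open>of_nat l * x\<close> alike.\<close>

theorem qEuler_multiplication:
  fixes q x :: 'a
  assumes "odd p" and q: "absp (q - 1) < exp_radius" and "odd l" and x: "absp x \<le> 1"
  shows "qtwo q / qtwo (q ^ l) * qbracket q 1 (of_nat l) ^ m *
      (\<Sum>i<l. qpow q (of_int (h * int i)) * (-1) ^ i *
        qEuler p q l h m ((x + of_nat i) / of_nat l))
    = qEuler p q 1 h m x"
proof -
  define F where "F l y n = qbracket q l (y + of_nat n) ^ m *
    qpow (q ^ l) (of_int (h - 1) * of_nat n) * qpow (q ^ l) (of_nat n)" for l y n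
  define S where "S i = alternating_sum (F l ((x + of_nat i) / of_nat l))" for i
  define w where "w i = qpow q (of_int (h * int i)) * (-1) ^ i" for i
  have l: "l > 0"
    using \<open>odd l\<close> by (simp add: odd_pos)
  have euler: "qEuler p q k h m y = qtwo (q ^ k) / 2 * L"
    if "(\<lambda>N. alternating_sum (F k y) (p ^ N)) \<longlonglongrightarrow> L" for k y L
    unfolding qEuler_def
    by (rule fermionic_integral_eq[OF \<open>odd p\<close> unit_ball_power[OF q]])
      (use that in \<open>simp add: F_def[abs_def]\<close>)
  have "padic_lipschitz (F 1 x)"
    unfolding F_def using x by (intro qEuler_integrand_lipschitz q) simp
  \<comment> \<open>The same \<open>L\<close> serves \<open>k = 1\<close> for the right-hand side
    and \<open>k = l\<close> for the left-hand side.\<close>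
  then obtain L where L: "\<And>k. odd k \<Longrightarrow> (\<lambda>N. alternating_sum (F 1 x) (k * p ^ N)) \<longlonglongrightarrow> L"
    using alternating_sum_converges \<open>odd p\<close> by blast
  \<comment> \<open>The point \<open>(x + i) / l\<close> may leave the unit ball, but multiplied by
    \<open>l\<close> it is \<open>x + i\<close>, which is what the Lipschitz lemma asks for.\<close>
  have "\<exists>M. (\<lambda>N. S i (p ^ N)) \<longlonglongrightarrow> M" for i
  proof -
    have "padic_lipschitz (F l ((x + of_nat i) / of_nat l))"
      unfolding F_def using x l
      by (intro qEuler_integrand_lipschitz q) (simp add: absp_add_le)
    then obtain M where "\<And>k. odd k \<Longrightarrow>
        (\<lambda>N. alternating_sum (F l ((x + of_nat i) / of_nat l)) (k * p ^ N)) \<longlonglongrightarrow> M"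
      using alternating_sum_converges \<open>odd p\<close> by blast
    from this[of 1] show ?thesis
      by (auto simp: S_def)
  qed
  then obtain M where M: "\<And>i. (\<lambda>N. S i (p ^ N)) \<longlonglongrightarrow> M i"
    by metis
  have le1: "absp (of_int a * of_nat n :: 'a) \<le> 1" for a n
    by (metis absp_of_int_le_1 of_int_mult of_int_of_nat_eq)
  \<comment> \<open>The integrand for base \<open>q ^ l\<close> at \<open>n\<close>, weighted for
    residue \<open>i\<close>, is the integrand for base \<open>q\<close> at
    \<open>i + n * l\<close>: the brackets multiply, and the exponents add up to
    \<open>h * (i + n * l)\<close>.\<close>
  have F_eq: "qbracket q 1 (of_nat l) ^ m * (qpow q (of_int (h * int i)) *
      F l ((x + of_nat i) / of_nat l) n) = F 1 x (i + n * l)" for i n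
  proof -
    have "of_nat l * ((x + of_nat i) / of_nat l + of_nat n) = x + of_nat (i + n * l)"
      using l by (simp add: field_simps)
    then have bracket: "qbracket q 1 (of_nat l) * qbracket q l ((x + of_nat i) / of_nat l + of_nat n) =
        qbracket q 1 (x + of_nat (i + n * l))"
      using qbracket_mult[OF q l] by metis
    have powers: "qpow q (of_int (h * int i)) *
        (qpow (q ^ l) (of_int (h - 1) * of_nat n) * qpow (q ^ l) (of_nat n)) =
        qpow q (of_int (h - 1) * of_nat (i + n * l)) * qpow q (of_nat (i + n * l))"
    proof -
      have "qpow (q ^ l) (of_int (h - 1) * of_nat n) * qpow (q ^ l) (of_nat n)
          = qpow (q ^ l) (of_int (h - 1) * of_nat n + of_nat n)"
        by (rule qpow_add[symmetric]) (intro unit_ball_power q le1 absp_of_nat_le_1)+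
      also have "\<dots> = qpow q (of_int h * of_nat (n * l))"
        by (simp add: qpow_power_base[OF q] algebra_simps)
      also have "qpow q (of_int (h * int i)) * \<dots>
          = qpow q (of_int (h * int i) + of_int h * of_nat (n * l))"
        by (rule qpow_add[symmetric]) (use q le1 absp_of_int_le_1 in blast)+
      also have "of_int (h * int i) + of_int h * of_nat (n * l) =
          (of_int (h - 1) * of_nat (i + n * l) + of_nat (i + n * l) :: 'a)"
        by (simp add: algebra_simps)
      also have "qpow q \<dots> = qpow q (of_int (h - 1) * of_nat (i + n * l)) * qpow q (of_nat (i + n * l))"
        by (rule qpow_add) (use q le1 absp_of_nat_le_1 in blast)+
      finally show ?thesis .
    qed
    have "qbracket q 1 (of_nat l) ^ m * (qpow q (of_int (h * int i)) *
        F l ((x + of_nat i) / of_nat l) n) =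
        (qbracket q 1 (of_nat l) * qbracket q l ((x + of_nat i) / of_nat l + of_nat n)) ^ m *
        (qpow q (of_int (h * int i)) *
          (qpow (q ^ l) (of_int (h - 1) * of_nat n) * qpow (q ^ l) (of_nat n)))"
      unfolding F_def by (simp only: power_mult_distrib mult_ac)
    also have "\<dots> = F 1 x (i + n * l)"
      unfolding bracket powers F_def power_one_right by (simp only: mult.assoc)
    finally show ?thesis .
  qed
  have split: "qbracket q 1 (of_nat l) ^ m * (\<Sum>i<l. w i * S i n) = alternating_sum (F 1 x) (l * n)" for n
  proof -
    \<comment> \<open>The factors are swapped to make the odd number \<open>l\<close> the block
      length; then \<open>i\<close> is the residue and \<open>k\<close> the quotient of the
      index.\<close>
    have "alternating_sum (F 1 x) (l * n) = alternating_sum (F 1 x) (n * l)"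
      by (simp add: mult.commute)
    also have "\<dots> = (\<Sum>k<n. \<Sum>i<l. (-1) ^ k * ((-1) ^ i * F 1 x (i + k * l)))"
      by (rule alternating_sum_mult[OF \<open>odd l\<close>])
    also have "\<dots> = (\<Sum>i<l. \<Sum>k<n. (-1) ^ k * ((-1) ^ i * F 1 x (i + k * l)))"
      by (rule sum.swap)
    also have "\<dots> = (\<Sum>i<l. \<Sum>k<n. qbracket q 1 (of_nat l) ^ m * (w i *
        ((-1) ^ k * F l ((x + of_nat i) / of_nat l) k)))"
      unfolding F_eq[symmetric] w_def by (simp only: mult_ac)
    finally show ?thesis
      by (simp add: S_def alternating_sum_def sum_distrib_left)
  qed
  have "(\<lambda>N. qbracket q 1 (of_nat l) ^ m * (\<Sum>i<l. w i * S i (p ^ N)))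
      \<longlonglongrightarrow> qbracket q 1 (of_nat l) ^ m * (\<Sum>i<l. w i * M i)"
    by (intro tendsto_cmult_absp tendsto_sum_absp M)
  moreover have "(\<lambda>N. qbracket q 1 (of_nat l) ^ m * (\<Sum>i<l. w i * S i (p ^ N))) \<longlonglongrightarrow> L"
    unfolding split by (rule L[OF \<open>odd l\<close>])
  \<comment> \<open>One sequence, two computations of its limit: termwise over the residues, and as
    the sums of length \<open>l * p ^ N\<close>.\<close>
  ultimately have sum_eq: "qbracket q 1 (of_nat l) ^ m * (\<Sum>i<l. w i * M i) = L"
    by (rule LIMSEQ_unique)
  have lhs: "(\<Sum>i<l. w i * qEuler p q l h m ((x + of_nat i) / of_nat l))
      = qtwo (q ^ l) / 2 * (\<Sum>i<l. w i * M i)"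
    unfolding euler[OF M[unfolded S_def]] sum_distrib_left by (simp only: mult_ac)
  have rhs: "qEuler p q 1 h m x = qtwo q / 2 * L"
    using euler[of 1 x L] L[of 1] by simp
  have "qtwo (q ^ l) \<noteq> 0"
    unfolding qtwo_def by (intro one_plus_unit_ball_nonzero \<open>odd p\<close> unit_ball_power q)
  then show ?thesis
    unfolding w_def[symmetric] lhs rhs sum_eq[symmetric] by simp
qed

end

theorem theorem5:
  fixes p l m :: nat and h :: int
    and q x :: "'a::{field_char_0,complete_space}"
  assumes "padic_complex_field p TYPE('a)"
    and "odd p"
    and "absp (1 - q) < real p powr (- 1 / (real p - 1))"
    and "odd l"
    and "x \<in> Zp"
  shows "qtwo q / qtwo (q ^ l) * qbracket q 1 (of_nat l) ^ m *
           (\<Sum>i<l. qpow q (of_int (h * int i)) * (-1) ^ i *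
              qEuler p q l h m ((x + of_nat i) / of_nat l))
         = qEuler p q 1 h m x
       \<and> qtwo q / qtwo (q ^ l) * qbracket q 1 (of_nat l) ^ m *
           (\<Sum>i<l. qpow q (of_int (h * int i)) * (-1) ^ i *
              qEuler p q l h m (x + of_nat i / of_nat l))
         = qEuler p q 1 h m (of_nat l * x)"
proof -
  interpret padic_field "TYPE('a)" p
    using assms(1) unfolding padic_complex_field_def by unfold_locales auto
  have q: "absp (q - 1) < exp_radius"
    using assms(3) by (simp add: exp_radius_def absp_minus_commute)
  have x: "absp x \<le> 1"
    using assms(5) by (simp add: Zp_def)
  have "absp (of_nat l * x) \<le> 1"
    using x by (simp add: absp_mult mult_le_one)
  \<comment> \<open>This turns the first identity at \<open>l * x\<close> into the second.\<close>
  moreover have "(of_nat l * x + of_nat i) / of_nat l = x + of_nat i / of_nat l" for i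
    using \<open>odd l\<close> by (simp add: add_divide_distrib odd_pos)
  ultimately show ?thesis
    using qEuler_multiplication[OF assms(2) q assms(4) x]
      qEuler_multiplication[OF assms(2) q assms(4), of "of_nat l * x"] by simp
qed

end
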